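(* Assume that $\Delta\neq 0$ and $\dfrac{a^2}{b}\notin\mathbb{F}_q$. Assume further that $e_1/e_1'\le p^k$ for some integer $k\ge 1$. Then, for any integer $e>e_{k+2}$, we have $$\beta(P)\le\beta(P^e)\le p^{k+1}\beta(P).$$
   Context: Let $\mathbb{F}_q$ be the finite field with $q=p^l$ elements, $p$ prime, $l\ge1$. Fix $a,b\in\mathbb{F}_q[x]$ with $b\neq 0$, and put $\Delta=a^2+4b$. The generalized Fibonacci sequence is $F_0=0$, $F_1=1$, $F_n=aF_{n-1}+bF_{n-2}$ for $n\ge 2$. Fix an irreducible polynomial $P\in\mathbb{F}_q[x]$ with $\gcd(b,P)=1$. For a non-constant $M\in\mathbb{F}_q[x]$ with $\gcd(b,M)=1$, the rank $\alpha(M)$ is the least positive integer $n$ with $F_n\equiv 0\pmod M$, the period $\pi(M)$ is the least positive integer $n$ with $F_n\equiv 0$ and $F_{n+1}\equiv 1\pmod M$, and $\beta(M)=\pi(M)/\alpha(M)$. For $i\ge 1$, $e_i$ denotes the $i$-th smallest positive integer $e$ such that $\alpha(P^e)\neq\alpha(P^{e+1})$, and $e_i'$ denotes the $i$-th smallest positive integer $e$ such that $\pi(P^e)\neq\pi(P^{e+1})$ (under the hypotheses of the claim, all $e_i$ and $e_i'$ exist). *)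

theory Defs
  imports
    "HOL-Computational_Algebra.Computational_Algebra"
    "HOL-Number_Theory.Cong"
    "HOL-Library.Infinite_Set"
begin

fun gfib :: "'a::comm_semiring_1 \<Rightarrow> 'a \<Rightarrow> nat \<Rightarrow> 'a" where
  "gfib a b 0 = 0"
| "gfib a b (Suc 0) = 1"
| "gfib a b (Suc (Suc n)) = a * gfib a b (Suc n) + b * gfib a b n"

(* For a finite coefficient field, M non-constant and coprime b M, the sets of n below
   are nonempty, so the two least elements exist.  For other M the values are junk. *)

definition fib_rank :: "'a::field poly \<Rightarrow> 'a poly \<Rightarrow> 'a poly \<Rightarrow> nat" where
  "fib_rank a b M = (LEAST n. n > 0 \<and> [gfib a b n = 0] (mod M))"

definition fib_period :: "'a::field poly \<Rightarrow> 'a poly \<Rightarrow> 'a poly \<Rightarrow> nat" where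
  "fib_period a b M =
     (LEAST n. n > 0 \<and> [gfib a b n = 0] (mod M) \<and> [gfib a b (n + 1) = 1] (mod M))"

definition fib_beta :: "'a::field poly \<Rightarrow> 'a poly \<Rightarrow> 'a poly \<Rightarrow> rat" where
  "fib_beta a b M = of_nat (fib_period a b M) / of_nat (fib_rank a b M)"

(* e_i and e_i'.  The index i starts at 1, whereas enumerate counts from 0.
   If the enumerated set had fewer than i elements, the value would be junk. *)

definition rank_jump :: "'a::field poly \<Rightarrow> 'a poly \<Rightarrow> 'a poly \<Rightarrow> nat \<Rightarrow> nat" where
  "rank_jump a b P i =
     enumerate {e. e > 0 \<and> fib_rank a b (P ^ e) \<noteq> fib_rank a b (P ^ (e + 1))} (i - 1)"

definition period_jump :: "'a::field poly \<Rightarrow> 'a poly \<Rightarrow> 'a poly \<Rightarrow> nat \<Rightarrow> nat" where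
  "period_jump a b P i =
     enumerate {e. e > 0 \<and> fib_period a b (P ^ e) \<noteq> fib_period a b (P ^ (e + 1))} (i - 1)"

end

theory Submission
  imports Defs
begin

text \<open>
  Let \<open>T\<close> be a root of \<open>T\<^sup>2 = a T + b\<close>.  Then \<open>T\<^sup>n = F\<^sub>n T + G\<^sub>n\<close>, where
  \<open>G\<^sub>n = F\<^sub>n\<^sub>+\<^sub>1 - a F\<^sub>n\<close>.  Modulo \<open>M\<close>, the rank is the order of \<open>T\<close> modulo scalars and the
  period is the order of \<open>T\<close> itself.  Since the characteristic is \<open>p\<close>, taking \<open>p\<close>-th powers
  gives \<open>F\<^sub>n\<^sub>p = F\<^sub>n\<^sup>p F\<^sub>p\<close> and \<open>G\<^sub>n\<^sub>p - 1 = F\<^sub>n\<^sup>p G\<^sub>p + (G\<^sub>n - 1)\<^sup>p\<close>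
  (\<open>gfib_mult_char\<close>, \<open>cofib_mult_char\<close>).  So multiplying an index by \<open>p\<close> multiplies the power of
  \<open>P\<close> for which it is a multiple of the rank, or of the period, by at least \<open>p\<close>.  Consequently
  \<open>\<alpha>(P\<^sup>e) = \<alpha>(P) p\<^sup>i\<close> and \<open>\<pi>(P\<^sup>e) = \<pi>(P) p\<^sup>j\<close>, and \<open>\<beta>(P\<^sup>e) / \<beta>(P)\<close> is \<open>p\<close> to the power
  \<open>j - i\<close>.  The claim becomes \<open>i \<le> j \<le> i + k + 1\<close>.

  For the lower bound, \<open>\<beta>(P)\<close> is the order of a scalar in a field of characteristic \<open>p\<close>, hence
  prime to \<open>p\<close>; as \<open>\<alpha>(P\<^sup>e)\<close> divides \<open>\<pi>(P\<^sup>e)\<close>, this forces \<open>i \<le> j\<close>.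

  For the upper bound, let \<open>v\<close> be the valuation of \<open>F\<^sub>n\<close> at \<open>P\<close> for \<open>n = \<alpha>(P)\<close>, and \<open>w\<close> that of
  \<open>F\<^sub>p\<close>.  The valuation at \<open>\<alpha>(P) p\<^sup>i\<close> is then \<open>p\<^sup>i v + (1 + \<dots> + p\<^sup>i\<^sup>-\<^sup>1) w\<close>.  Here \<open>w \<le> v\<close>:
  if \<open>P\<close> divides \<open>F\<^sub>p\<close>, then \<open>\<alpha>(P)\<close> is a divisor of \<open>p\<close> other than \<open>1\<close>, so \<open>\<alpha>(P) = p\<close> and
  \<open>w = v\<close>.  Therefore \<open>e \<le> p\<^sup>i\<^sup>+\<^sup>1 v\<close> (\<open>valuation_F_le\<close>).  The first jump of the rank occurs at
  \<open>e\<^sub>1 = v\<close>, and at the first jump \<open>\<mu>\<close> of the period, \<open>\<pi>(P)\<close> is still a period modulo \<open>P\<^sup>\<mu>\<close>.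
  The hypothesis \<open>v \<le> p\<^sup>k \<mu>\<close> gives \<open>e \<le> \<mu> p\<^sup>i\<^sup>+\<^sup>k\<^sup>+\<^sup>1\<close>, so \<open>\<pi>(P) p\<^sup>i\<^sup>+\<^sup>k\<^sup>+\<^sup>1\<close> is a period modulo
  \<open>P\<^sup>e\<close>, that is, \<open>j \<le> i + k + 1\<close> (\<open>period_exponent_le\<close>).

  The jumps exist because no \<open>F\<^sub>n\<close> with \<open>n > 0\<close> vanishes (\<open>gfib_nonzero\<close>): a zero would make
  \<open>a\<^sup>2 / b\<close> algebraic over the coefficient field, hence constant.
\<close>

section \<open>Powers of the companion element\<close>

text \<open>The constant coefficient of \<open>T\<^sup>n\<close> on the basis \<open>1, T\<close>; for \<open>n > 0\<close> it is \<open>b F\<^sub>n\<^sub>-\<^sub>1\<close>.  Starting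
  from \<open>F\<^sub>n\<^sub>+\<^sub>1 - a F\<^sub>n\<close> gives the right value \<open>1\<close> at \<open>n = 0\<close> as well.\<close>
definition cofib :: "'a::comm_ring_1 \<Rightarrow> 'a \<Rightarrow> nat \<Rightarrow> 'a" where
  "cofib a b n = gfib a b (Suc n) - a * gfib a b n"

lemma cofib_0 [simp]: "cofib a b 0 = 1"
  and cofib_Suc [simp]: "cofib a b (Suc n) = b * gfib a b n"
  by (simp_all add: cofib_def)

lemma gfib_Suc: "gfib a b (Suc n) = a * gfib a b n + cofib a b n"
  by (simp add: cofib_def)

text \<open>Compare coefficients in \<open>T\<^sup>m\<^sup>+\<^sup>n = T\<^sup>m T\<^sup>n\<close>.\<close>
lemma gfib_add:
  "gfib a b (m + n) =
     a * gfib a b m * gfib a b n + gfib a b m * cofib a b n + cofib a b m * gfib a b n"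
  and cofib_add:
  "cofib a b (m + n) = b * gfib a b m * gfib a b n + cofib a b m * cofib a b n"
proof (induction m)
  case (Suc m)
  {
    case 1
    show ?case
      by (simp add: gfib_Suc Suc del: gfib.simps(3)) (simp add: algebra_simps)
  next
    case 2
    show ?case
      by (simp add: gfib_Suc Suc del: gfib.simps(3)) (simp add: algebra_simps)
  }
qed simp_all

text \<open>Both sides are the norm of \<open>T\<^sup>n\<close>, and the norm of \<open>T\<close> is \<open>- b\<close>.\<close>
lemma cofib_norm:
  "(a * gfib a b n + cofib a b n) * cofib a b n - b * gfib a b n ^ 2 = (- b) ^ n"
proof (induction n)
  case (Suc n)
  have "(a * gfib a b (Suc n) + cofib a b (Suc n)) * cofib a b (Suc n) - b * gfib a b (Suc n) ^ 2 =
        - b * ((a * gfib a b n + cofib a b n) * cofib a b n - b * gfib a b n ^ 2)"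
    by (simp add: gfib_Suc power2_eq_square algebra_simps del: gfib.simps(3))
  then show ?case
    by (simp add: Suc)
qed simp

lemma diff_dvd_diff_power:
  fixes x y :: "'a::comm_ring_1"
  shows "x - y dvd x ^ n - y ^ n"
  by (cases n) (simp_all add: diff_power_eq_sum del: power_Suc)

text \<open>The identity \<open>T\<^sup>n = F\<^sub>n T + G\<^sub>n\<close>, as a congruence modulo the characteristic polynomial
  \<open>T\<^sup>2 - a T - b\<close> among polynomials in \<open>T\<close>.\<close>
lemma companion_dvd_power:
  fixes a b :: "'a::comm_ring_1"
  shows "[:- b, - a, 1:] dvd monom 1 n - [:cofib a b n, gfib a b n:]"
proof (induction n)
  case (Suc n)
  have "monom 1 (Suc n) - [:cofib a b (Suc n), gfib a b (Suc n):] =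
      [:0, 1:] * (monom 1 n - [:cofib a b n, gfib a b n:]) +
      [:gfib a b n:] * [:- b, - a, 1:]"
    by (simp add: gfib_Suc monom_Suc algebra_simps)
  moreover have "[:- b, - a, 1:] dvd \<dots>"
    using Suc by (intro dvd_add dvd_mult dvd_refl)
  ultimately show ?case
    by (simp only:)
qed (simp add: monom_0)

text \<open>The characteristic polynomial has degree 2, so it divides no nonzero linear polynomial:
  coefficients on the basis \<open>1, T\<close> are well defined.\<close>
lemma companion_dvd_imp_eq:
  fixes a b :: "'a::idom"
  assumes "[:- b, - a, 1:] dvd [:x, y:] - [:x', y':]"
  shows "x = x'" and "y = y'"
proof -
  have "[:x - x', y - y':] = 0"
  proof (rule ccontr)
    assume "[:x - x', y - y':] \<noteq> 0"
    moreover have "[:- b, - a, 1:] dvd [:x - x', y - y':]"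
      using assms by simp
    ultimately have "degree [:- b, - a, 1:] \<le> degree [:x - x', y - y':]"
      by (rule dvd_imp_degree_le[rotated])
    then show False
      by (simp split: if_splits)
  qed
  then show "x = x'" and "y = y'"
    by simp_all
qed

section \<open>The Frobenius map\<close>

text \<open>By the binomial theorem in characteristic \<open>p\<close>,
  \<open>T\<^sup>n\<^sup>p = (F\<^sub>n T + G\<^sub>n)\<^sup>p = F\<^sub>n\<^sup>p T\<^sup>p + G\<^sub>n\<^sup>p\<close>; now expand \<open>T\<^sup>p = F\<^sub>p T + G\<^sub>p\<close>.\<close>
lemma
  fixes a b :: "'a::idom"
  assumes "prime p" and char: "CHAR('a) = p"
  shows gfib_mult_char: "gfib a b (n * p) = gfib a b n ^ p * gfib a b p"
    and cofib_mult_char: "cofib a b (n * p) = gfib a b n ^ p * cofib a b p + cofib a b n ^ p"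
proof -
  let ?C = "[:- b, - a, 1:]"
  let ?f = "gfib a b n" and ?g = "cofib a b n"
  have "p > 0"
    using assms by (simp add: prime_gt_0_nat)
  have 1: "?C dvd monom 1 (n * p) - [:?g, ?f:] ^ p"
    using dvd_trans[OF companion_dvd_power diff_dvd_diff_power[of _ _ p]]
    by (simp add: monom_power)
  have "[:?g, ?f:] = [:?g:] + monom ?f 1"
    by (simp add: monom_altdef)
  then have "[:?g, ?f:] ^ p = [:?g:] ^ p + monom ?f 1 ^ p"
    using assms by (simp add: freshmans_dream)
  also have "\<dots> = [:?g ^ p:] + [:?f ^ p:] * monom 1 p"
    by (simp add: monom_power poly_const_pow smult_monom)
  finally have 2: "[:?g, ?f:] ^ p = [:?g ^ p:] + [:?f ^ p:] * monom 1 p" .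
  have "?C dvd [:?f ^ p:] * (monom 1 p - [:cofib a b p, gfib a b p:])"
    by (intro dvd_mult companion_dvd_power)
  then have "?C dvd (monom 1 (n * p) - [:?g, ?f:] ^ p)
      + [:?f ^ p:] * (monom 1 p - [:cofib a b p, gfib a b p:])
      - (monom 1 (n * p) - [:cofib a b (n * p), gfib a b (n * p):])"
    by (rule dvd_diff[OF dvd_add[OF 1] companion_dvd_power])
  also have "\<dots> = [:cofib a b (n * p), gfib a b (n * p):]
      - [:?f ^ p * cofib a b p + ?g ^ p, ?f ^ p * gfib a b p:]"
    unfolding 2 by (simp add: algebra_simps)
  finally have *: "?C dvd \<dots>" .
  show "gfib a b (n * p) = ?f ^ p * gfib a b p"
    by (rule companion_dvd_imp_eq(2)[OF *])
  show "cofib a b (n * p) = ?f ^ p * cofib a b p + ?g ^ p"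
    by (rule companion_dvd_imp_eq(1)[OF *])
qed

text \<open>Translation by \<open>1\<close> permutes the field, so summing all elements shows that the number of elements
  is zero in the field.\<close>
lemma CHAR_finite_field:
  assumes "prime p" and "card (UNIV :: 'a::{field,finite} set) = p ^ l"
  shows "CHAR('a) = p"
proof -
  have "(\<Sum>x\<in>(UNIV :: 'a set). x + 1) = (\<Sum>x\<in>UNIV. x)"
    by (rule sum.reindex_bij_witness[of _ "\<lambda>x. x - 1" "\<lambda>x. x + 1"]) auto
  then have "of_nat (p ^ l) = (0 :: 'a)"
    by (simp add: sum.distrib flip: assms(2))
  then have "CHAR('a) dvd p ^ l"
    using of_nat_eq_0_iff_char_dvd by blast
  moreover have "prime CHAR('a)"
    by (simp add: finite_imp_CHAR_pos prime_CHAR_semidom)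
  ultimately show ?thesis
    using assms(1) by (metis prime_dvd_power primes_dvd_imp_eq)
qed

section \<open>Non-vanishing of the sequence\<close>

text \<open>\<open>F\<^sub>n\<^sub>+\<^sub>1\<close> is homogeneous of degree \<open>n\<close> when \<open>a\<close> has weight 1 and \<open>b\<close> has weight 2.\<close>
lemma gfib_homogeneous:
  fixes a b c :: "'a::comm_ring_1"
  shows "gfib (c * a) (c ^ 2 * b) (Suc n) = c ^ n * gfib a b (Suc n)"
proof (induction n rule: less_induct)
  case (less n)
  consider "n = 0" | "n = 1" | m where "n = Suc (Suc m)"
    by (metis One_nat_def not0_implies_Suc)
  then show ?case
  proof cases
    case 3
    then show ?thesis
      using less[of m] less[of "Suc m"] by (simp add: algebra_simps power2_eq_square)
  qed simp_all
qed

lemma gfib_cong_power: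
  fixes a b d :: "'a::comm_ring_1"
  assumes "d dvd b"
  shows "d dvd gfib a b (Suc n) - a ^ n"
proof (induction n)
  case (Suc n)
  have "gfib a b (Suc (Suc n)) - a ^ Suc n = a * (gfib a b (Suc n) - a ^ n) + b * gfib a b n"
    by (simp add: algebra_simps)
  moreover have "d dvd a * (gfib a b (Suc n) - a ^ n) + b * gfib a b n"
    using Suc assms by (intro dvd_add dvd_mult dvd_mult2[of d b])
  ultimately show ?case
    by (simp only:)
qed simp

lemma exists_irreducible_factor_poly:
  fixes B :: "'a::field poly"
  assumes "degree B > 0"
  shows "\<exists>Q. irreducible Q \<and> Q dvd B"
  using assms
proof (induction "degree B" arbitrary: B rule: less_induct)
  case less
  show ?case
  proof (cases "irreducible B")
    case False
    have "B \<noteq> 0"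
      using less.prems by auto
    then have "\<not> is_unit B"
      using less.prems by (simp add: is_unit_iff_degree)
    with False \<open>B \<noteq> 0\<close> obtain C D where CD: "B = C * D" "\<not> is_unit C" "\<not> is_unit D"
      by (auto simp: irreducible_def)
    then have "C \<noteq> 0" "D \<noteq> 0"
      using \<open>B \<noteq> 0\<close> by auto
    with CD have "degree C > 0" "degree D > 0"
      using is_unit_iff_degree[of C] is_unit_iff_degree[of D] by auto
    moreover from \<open>C \<noteq> 0\<close> \<open>D \<noteq> 0\<close> have "degree B = degree C + degree D"
      by (simp add: CD(1) degree_mult_eq)
    ultimately show ?thesis
      using less.hyps[of C] CD(1) by (auto intro: dvd_mult2)
  qed auto
qed

text \<open>Here \<open>F\<^sub>n\<^sub>+\<^sub>2 = A (F\<^sub>n\<^sub>+\<^sub>1 + c F\<^sub>n)\<close>, and \<open>F\<^sub>n\<^sub>+\<^sub>1\<close> dominates in the second factor.  Thus each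
  step raises the degree.\<close>
lemma degree_gfib_less:
  fixes A :: "'a::field poly" and c :: 'a
  assumes "degree A > 0"
  shows "gfib A (A * [:c:]) (Suc n) \<noteq> 0 \<and>
    (gfib A (A * [:c:]) n = 0 \<or> degree (gfib A (A * [:c:]) n) < degree (gfib A (A * [:c:]) (Suc n)))"
proof (induction n)
  case (Suc n)
  let ?F = "gfib A (A * [:c:])"
  have step: "?F (Suc (Suc n)) = A * (?F (Suc n) + smult c (?F n))"
    by (simp add: algebra_simps)
  have "degree (smult c (?F n)) < degree (?F (Suc n)) \<or> smult c (?F n) = 0"
    using Suc by (auto)
  then have deg: "degree (?F (Suc n) + smult c (?F n)) = degree (?F (Suc n))"
    by (auto simp: degree_add_eq_left)
  have nz: "?F (Suc n) + smult c (?F n) \<noteq> 0"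
  proof
    assume *: "?F (Suc n) + smult c (?F n) = 0"
    then have "?F (Suc n) = - smult c (?F n)"
      by (simp add: eq_neg_iff_add_eq_0)
    with Suc * show False
      by (cases "c = 0") (auto simp del: gfib.simps)
  qed
  have "A \<noteq> 0"
    using assms by auto
  with nz deg assms show ?case
    unfolding step by (simp add: degree_mult_eq)
qed simp

text \<open>A descent on the denominator \<open>B\<close> of the fraction \<open>A / B\<close>.  A non-constant \<open>B\<close> has an irreducible
  factor \<open>Q\<close>.  Modulo \<open>Q\<close> the sequence is \<open>A\<^sup>n\<close>, so \<open>Q\<close> divides \<open>A\<close> too, and homogeneity cancels
  \<open>Q\<close> from both.  For constant \<open>B\<close>, growth of degrees forces \<open>A\<close> to be constant.\<close>
lemma gfib_eq_0_imp_scalar_multiple: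
  fixes A B :: "'a::field poly"
  assumes "B \<noteq> 0" and "gfib A (A * B) (Suc n) = 0"
  shows "\<exists>c. A = smult c B"
  using assms
proof (induction "degree B" arbitrary: A B rule: less_induct)
  case less
  show ?case
  proof (cases "degree B = 0")
    case True
    then obtain d where d: "B = [:d:]"
      by (meson degree_eq_zeroE)
    have "degree A = 0"
      using degree_gfib_less[of A d n] less.prems(2) d by (auto simp del: gfib.simps)
    then obtain c where "A = [:c:]"
      by (meson degree_eq_zeroE)
    then have "A = smult (c / d) B"
      using d less.prems(1) by simp
    then show ?thesis ..
  next
    case False
    then obtain Q where Q: "irreducible Q" "Q dvd B"
      using exists_irreducible_factor_poly by blast
    then have "prime_elem Q"
      by (simp add: field_poly_irreducible_imp_prime)
    obtain B' where B': "B = Q * B'"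
      using Q by auto
    have "Q dvd A * B"
      using Q(2) by simp
    from gfib_cong_power[OF this, of A n] less.prems(2) have "Q dvd A ^ n"
      by (simp del: gfib.simps)
    then have "Q dvd A"
      by (rule prime_elem_dvd_power[OF \<open>prime_elem Q\<close>])
    then obtain A' where A': "A = Q * A'"
      by auto
    have "B' \<noteq> 0" "Q \<noteq> 0"
      using B' less.prems(1) by auto
    moreover have "degree Q > 0"
      using irreducible_not_unit[OF Q(1)] \<open>Q \<noteq> 0\<close> by (simp add: is_unit_iff_degree)
    ultimately have "degree B' < degree B"
      by (simp add: B' degree_mult_eq)
    moreover have "gfib A' (A' * B') (Suc n) = 0"
    proof -
      have "gfib A (A * B) (Suc n) = gfib (Q * A') (Q ^ 2 * (A' * B')) (Suc n)"
        by (simp add: A' B' power2_eq_square ac_simps)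
      then show ?thesis
        using gfib_homogeneous[of Q A' "A' * B'" n] less.prems(2) \<open>Q \<noteq> 0\<close> by simp
    qed
    ultimately obtain c where "A' = smult c B'"
      using less.hyps \<open>B' \<noteq> 0\<close> by blast
    then have "A = smult c B"
      by (simp add: A' B')
    then show ?thesis ..
  qed
qed

text \<open>Rescaling \<open>(a, b)\<close> to \<open>(a\<^sup>2, a\<^sup>2 b)\<close> by homogeneity turns the hypothesis on \<open>a\<^sup>2 / b\<close> into the
  descent above with \<open>A = a\<^sup>2\<close> and \<open>B = b\<close>.\<close>
lemma gfib_nonzero:
  fixes a b :: "'a::field poly"
  assumes "b \<noteq> 0"
    and ratio: "to_fract (a ^ 2) / to_fract b \<notin> range (\<lambda>c::'a. to_fract [:c:])"
    and "n > 0"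
  shows "gfib a b n \<noteq> 0"
proof
  assume zero: "gfib a b n = 0"
  obtain m where m: "n = Suc m"
    using \<open>n > 0\<close> gr0_implies_Suc by blast
  have "gfib (a ^ 2) (a ^ 2 * b) (Suc m) = 0"
    using gfib_homogeneous[of a a b m] zero m by (simp add: power2_eq_square)
  then obtain c where c: "a ^ 2 = smult c b"
    using gfib_eq_0_imp_scalar_multiple \<open>b \<noteq> 0\<close> by blast
  have "to_fract (a ^ 2) = to_fract [:c:] * to_fract b"
    unfolding c by (simp flip: to_fract_mult)
  then have "to_fract (a ^ 2) / to_fract b = to_fract [:c:]"
    using \<open>b \<noteq> 0\<close> by simp
  with ratio show False
    by blast
qed

section \<open>Divisibility, residues and first changes\<close>

text \<open>A set of indices closed under sums and cancellation is the nonnegative part of a subgroup of the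
  integers.
  This is why ranks and periods are governed by divisibility.\<close>
lemma Least_dvd_iff:
  fixes Q :: "nat \<Rightarrow> bool"
  assumes add: "\<And>m n. Q m \<Longrightarrow> Q n \<Longrightarrow> Q (m + n)"
    and cancel: "\<And>m n. Q (m + n) \<Longrightarrow> Q n \<Longrightarrow> Q m"
    and ex: "N > 0" "Q N"
  shows "Q n \<longleftrightarrow> (LEAST n. n > 0 \<and> Q n) dvd n"
proof -
  define d where "d = (LEAST n. n > 0 \<and> Q n)"
  have d: "d > 0" "Q d"
    using LeastI[of "\<lambda>n. n > 0 \<and> Q n" N] ex by (auto simp: d_def)
  have least: "d \<le> n" if "n > 0" "Q n" for n
    unfolding d_def using that by (simp add: Least_le)
  have mult: "Q (k * d)" for k
  proof (induction k)
    case 0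
    show ?case
      using cancel[of 0 d] d by simp
  qed (simp add: add d)
  have "d dvd n" if "Q n"
  proof -
    have "Q (n mod d)"
      using cancel[of "n mod d" "n div d * d"] mult that by simp
    then have "n mod d = 0"
      using least[of "n mod d"] d(1) by (meson gr0I leD mod_less_divisor)
    then show ?thesis by auto
  qed
  moreover have "Q n" if "d dvd n"
    using mult that by (metis dvd_def mult.commute)
  ultimately show ?thesis
    unfolding d_def by blast
qed

lemma prime_elem_power_dvd_mult_cancel:
  fixes P :: "'a::algebraic_semidom"
  assumes "prime_elem P" "P ^ e dvd x * y" "\<not> P dvd y"
  shows "P ^ e dvd x"
proof -
  obtain i j where ij: "i + j = e" "P ^ i dvd x" "P ^ j dvd y"
    using prime_elem_power_dvd_prod[OF assms(2,1)] by auto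
  moreover have "P dvd P ^ j" if "j > 0"
    using that by (simp add: dvd_power)
  ultimately have "j = 0"
    using assms(3) dvd_trans[of P "P ^ j" y] by blast
  with ij show ?thesis by simp
qed

text \<open>Non-divisibility by \<open>P\<^sup>v\<^sup>+\<^sup>1\<close> expresses that the valuation at \<open>P\<close> is at most \<open>v\<close>.  Only such
  upper bounds are ever required, and they are subadditive.\<close>
lemma prime_elem_power_not_dvd_mult:
  fixes P :: "'a::algebraic_semidom"
  assumes "prime_elem P" "\<not> P ^ Suc v dvd x" "\<not> P ^ Suc w dvd y"
  shows "\<not> P ^ Suc (v + w) dvd x * y"
proof
  assume "P ^ Suc (v + w) dvd x * y"
  then obtain i j where ij: "i + j = Suc (v + w)" "P ^ i dvd x" "P ^ j dvd y"
    using prime_elem_power_dvd_prod[OF _ assms(1), of "Suc (v + w)"] by blast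
  then have "Suc v \<le> i \<or> Suc w \<le> j" by linarith
  then have "P ^ Suc v dvd x \<or> P ^ Suc w dvd y"
    using ij(2,3) power_le_dvd by blast
  with assms(2,3) show False
    by blast
qed

lemma prime_elem_power_not_dvd_power:
  fixes P :: "'a::algebraic_semidom"
  assumes "prime_elem P" "\<not> P ^ Suc v dvd x"
  shows "\<not> P ^ Suc (n * v) dvd x ^ n"
proof (induction n)
  case 0
  show ?case
    using assms(1) by (simp add: prime_elem_def)
next
  case (Suc n)
  show ?case
    using prime_elem_power_not_dvd_mult[OF assms Suc] by simp
qed

lemma dvd_between_prime_power:
  fixes p d x :: nat
  assumes "prime p" "d dvd x" "x dvd d * p ^ m" "d > 0"
  shows "\<exists>i. x = d * p ^ i"
proof -
  from assms(2) obtain y where y: "x = d * y" ..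
  with assms have "y dvd p ^ m" by simp
  with \<open>prime p\<close> y show ?thesis
    by (auto simp: divides_primepow_nat)
qed

lemma power_dvd_all_imp_0:
  fixes P :: "'a::field poly"
  assumes "irreducible P" "\<And>e. P ^ Suc e dvd f"
  shows "f = 0"
proof (rule ccontr)
  assume "f \<noteq> 0"
  have "P \<noteq> 0"
    using assms(1) by auto
  then have "degree P > 0"
    using irreducible_not_unit[OF assms(1)] by (simp add: is_unit_iff_degree)
  have "degree (P ^ Suc (degree f)) \<le> degree f"
    using assms(2) \<open>f \<noteq> 0\<close> by (rule dvd_imp_degree_le)
  moreover have "degree (P ^ Suc (degree f)) = Suc (degree f) * degree P"
    using \<open>P \<noteq> 0\<close> by (rule degree_power_eq)
  ultimately show False
    using \<open>degree P > 0\<close> by (cases "degree P") auto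
qed

lemma finite_poly_degree_le: "finite {f :: 'a::{finite,zero} poly. degree f \<le> d}"
proof (rule finite_subset)
  show "{f :: 'a poly. degree f \<le> d} \<subseteq> Poly ` {xs. set xs \<subseteq> UNIV \<and> length xs \<le> Suc d}"
  proof
    fix f :: "'a poly"
    assume "f \<in> {f. degree f \<le> d}"
    then have "f = Poly (coeffs f)" "length (coeffs f) \<le> Suc d"
      by simp (use \<open>f \<in> _\<close> in \<open>simp add: coeffs_def\<close>)
    then show "f \<in> Poly ` {xs. set xs \<subseteq> UNIV \<and> length xs \<le> Suc d}"
      by blast
  qed
  show "finite (Poly ` {xs :: 'a list. set xs \<subseteq> UNIV \<and> length xs \<le> Suc d})"
    by (intro finite_imageI finite_lists_length_le) simp
qed

text \<open>The first jump of a sequence: the least index at which the value changes still carries the initial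
  value.  Some value must differ from the first one, as otherwise there is no jump.\<close>
lemma Least_change:
  fixes f :: "nat \<Rightarrow> 'b"
  assumes "\<exists>e>0. f e \<noteq> f 1"
  defines "m \<equiv> enumerate {e. e > 0 \<and> f e \<noteq> f (e + 1)} 0"
  shows "m > 0" and "f m = f 1" and "f (m + 1) \<noteq> f m"
proof -
  let ?Q = "\<lambda>e. e > 0 \<and> f e \<noteq> f (e + 1)"
  have m: "m = (LEAST e. ?Q e)"
    by (simp add: m_def enumerate_0)
  have const: "f e = f 1" if "e > 0" "\<forall>e'<e. \<not> ?Q e'" for e
    using that
  proof (induction e)
    case (Suc e)
    then show ?case by (cases "e = 0") auto
  qed simp
  have "\<exists>e. ?Q e"
    using const assms(1) by blast
  then have "?Q m"
    unfolding m by (rule LeastI_ex)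
  then show "m > 0" "f (m + 1) \<noteq> f m"
    by auto
  have "\<forall>e<m. \<not> ?Q e"
    unfolding m using not_less_Least by blast
  then show "f m = f 1"
    using const \<open>m > 0\<close> by blast
qed

section \<open>Ranks and periods modulo powers of a prime\<close>

text \<open>The condition \<open>T\<^sup>n = 1\<close> modulo \<open>M\<close>, in coordinates.\<close>
definition is_fib_period :: "'a::comm_ring_1 \<Rightarrow> 'a \<Rightarrow> 'a \<Rightarrow> nat \<Rightarrow> bool" where
  "is_fib_period a b M n \<longleftrightarrow> M dvd gfib a b n \<and> M dvd cofib a b n - 1"

text \<open>The norm of \<open>T\<^sup>n\<close> is a power of \<open>- b\<close>, a unit modulo \<open>P\<close>, so the two coordinates do not both vanish
  modulo \<open>P\<close>.\<close>
lemma prime_elem_not_dvd_cofib: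
  fixes a b P :: "'a::idom"
  assumes "prime_elem P" "\<not> P dvd b" "P dvd gfib a b n"
  shows "\<not> P dvd cofib a b n"
proof
  assume "P dvd cofib a b n"
  with assms(3) have "P dvd (a * gfib a b n + cofib a b n) * cofib a b n - b * gfib a b n ^ 2"
    by (simp add: power2_eq_square)
  then have "P dvd (- b) ^ n"
    by (simp only: cofib_norm)
  then have "P dvd - b"
    by (rule prime_elem_dvd_power[OF assms(1)])
  then show False
    using assms(2) by simp
qed

text \<open>If \<open>T\<^sup>m\<^sup>+\<^sup>n = T\<^sup>m\<close> modulo \<open>P\<^sup>e\<close>, then \<open>T\<^sup>n = 1\<close>.  The hypotheses are two linear equations in
  \<open>F\<^sub>n\<close> and \<open>G\<^sub>n - 1\<close> whose determinant is the norm \<open>(- b)\<^sup>m\<close>; the two identities in the proof are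
  Cramer's rule.\<close>
lemma is_fib_period_cancel:
  fixes a b P :: "'a::{idom,algebraic_semidom}"
  assumes "prime_elem P" "\<not> P dvd b"
    and F: "P ^ e dvd gfib a b (m + n) - gfib a b m"
    and G: "P ^ e dvd cofib a b (m + n) - cofib a b m"
  shows "is_fib_period a b (P ^ e) n"
proof -
  let ?f = "gfib a b m" and ?g = "cofib a b m"
  have nd: "\<not> P dvd (- b) ^ m"
    using assms(2) prime_elem_dvd_power[OF assms(1), of "- b" m] by auto
  have "gfib a b n * (- b) ^ m =
      ?g * (gfib a b (m + n) - ?f) - ?f * (cofib a b (m + n) - ?g)"
    unfolding gfib_add cofib_add cofib_norm[of a b m, symmetric]
    by (simp add: algebra_simps power2_eq_square)
  moreover have "(cofib a b n - 1) * (- b) ^ m =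
      (a * ?f + ?g) * (cofib a b (m + n) - ?g) - b * ?f * (gfib a b (m + n) - ?f)"
    unfolding gfib_add cofib_add cofib_norm[of a b m, symmetric]
    by (simp add: algebra_simps power2_eq_square)
  ultimately have "P ^ e dvd gfib a b n * (- b) ^ m"
    and "P ^ e dvd (cofib a b n - 1) * (- b) ^ m"
    using F G by simp_all
  from this[THEN prime_elem_power_dvd_mult_cancel[OF assms(1) _ nd]] show ?thesis
    by (simp add: is_fib_period_def)
qed

locale gfib_mod_prime =
  fixes a b P :: "'a::{field,finite} poly" and p :: nat
  assumes irreducible_P: "irreducible P"
    and coprime_b_P: "coprime b P"
    and prime_p: "prime p"
    and CHAR_eq: "CHAR('a) = p"
begin

abbreviation "F \<equiv> gfib a b"
abbreviation "G \<equiv> cofib a b"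
abbreviation "period_of \<equiv> is_fib_period a b"

lemma prime_P: "prime_elem P"
  using irreducible_P by (rule field_poly_irreducible_imp_prime)

lemma not_P_dvd_b: "\<not> P dvd b"
proof
  assume "P dvd b"
  then have "is_unit P"
    using coprime_common_divisor[OF coprime_b_P, of P] by simp
  with irreducible_not_unit[OF irreducible_P] show False
    by contradiction
qed

lemma P_dvd_power: "e > 0 \<Longrightarrow> P dvd P ^ e"
  by (rule dvd_power) simp

lemma p_pos: "p > 0"
  using prime_p by (rule prime_gt_0_nat)

lemma F_mult_p: "F (n * p) = F n ^ p * F p"
  and G_mult_p: "G (n * p) = F n ^ p * G p + G n ^ p"
  by (rule gfib_mult_char[OF prime_p], simp add: CHAR_eq)
    (rule cofib_mult_char[OF prime_p], simp add: CHAR_eq)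

lemma power_p_diff: "(x - y) ^ p = x ^ p - (y :: 'a poly) ^ p"
proof -
  have "prime CHAR('a poly)" and "p = CHAR('a poly)"
    using prime_p by (simp_all add: CHAR_eq)
  from freshmans_dream[OF this, of "x - y" y] have "(x - y) ^ p + y ^ p = x ^ p"
    by simp
  then show ?thesis by (simp add: algebra_simps)
qed

lemma rank_iff_cong: "[F n = 0] (mod M) \<longleftrightarrow> M dvd F n"
  by (simp add: cong_iff_dvd_diff)

lemma period_iff_cong:
  "[F n = 0] (mod M) \<and> [F (n + 1) = 1] (mod M) \<longleftrightarrow> period_of M n"
proof -
  have "F (n + 1) - 1 = a * F n + (G n - 1)"
    by (simp add: gfib_Suc del: gfib.simps)
  then have "M dvd F (n + 1) - 1 \<longleftrightarrow> M dvd G n - 1" if "M dvd F n"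
    using that by (simp only: dvd_add_right_iff dvd_mult)
  then show ?thesis
    by (auto simp: is_fib_period_def cong_iff_dvd_diff simp del: gfib.simps)
qed

text \<open>There are finitely many residues modulo \<open>P\<close>, so two powers of \<open>T\<close> agree; cancel the smaller one.\<close>
lemma exists_period_P: "\<exists>n>0. period_of P n"
proof -
  define R where "R n = (F n mod P, G n mod P)" for n
  let ?D = "{f :: 'a poly. degree f \<le> degree P}"
  have "P \<noteq> 0"
    using irreducible_P by auto
  then have "f mod P \<in> ?D" for f
    using degree_mod_less[of P f] by auto
  then have "range R \<subseteq> ?D \<times> ?D"
    by (auto simp: R_def)
  then have "finite (range R)"
    using finite_poly_degree_le finite_subset by blast
  then have "\<not> inj R"
    using finite_imageD by auto
  then obtain i j where "i < j" "R i = R j"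
    unfolding inj_def by (metis linorder_neqE_nat)
  then obtain n where n: "j = i + n" "n > 0"
    using less_imp_add_positive by blast
  have "F (i + n) mod P = F i mod P" "G (i + n) mod P = G i mod P"
    using \<open>R i = R j\<close> by (simp_all add: R_def n)
  then have "P dvd F (i + n) - F i" "P dvd G (i + n) - G i"
    by (simp_all add: mod_eq_dvd_iff)
  then have "period_of P n"
    using is_fib_period_cancel[OF prime_P not_P_dvd_b, of 1] by simp
  with n show ?thesis by blast
qed

lemma rank_mult_p:
  assumes "P ^ e dvd F n"
  shows "P ^ (e * p) dvd F (n * p)"
  unfolding F_mult_p power_mult by (intro dvd_mult2 dvd_power_same assms)

lemma period_mult_p:
  assumes "period_of (P ^ e) n"
  shows "period_of (P ^ (e * p)) (n * p)"
proof -
  have "G (n * p) - 1 = F n ^ p * G p + (G n - 1) ^ p"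
    by (simp add: G_mult_p power_p_diff)
  moreover have "P ^ (e * p) dvd F n ^ p" "P ^ (e * p) dvd (G n - 1) ^ p"
    using assms unfolding is_fib_period_def power_mult by (blast intro: dvd_power_same)+
  ultimately have "P ^ (e * p) dvd G (n * p) - 1"
    by (simp only: dvd_add dvd_mult2)
  then show ?thesis
    using assms rank_mult_p[of e n] by (simp only: is_fib_period_def)
qed

lemma rank_mult_p_power: "P ^ e dvd F n \<Longrightarrow> P ^ (e * p ^ m) dvd F (n * p ^ m)"
proof (induction m)
  case (Suc m)
  then show ?case
    using rank_mult_p[of "e * p ^ m" "n * p ^ m"] by (simp add: ac_simps)
qed simp

lemma period_mult_p_power: "period_of (P ^ e) n \<Longrightarrow> period_of (P ^ (e * p ^ m)) (n * p ^ m)"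
proof (induction m)
  case (Suc m)
  then show ?case
    using period_mult_p[of "e * p ^ m" "n * p ^ m"] by (simp add: ac_simps)
qed simp

lemma period_dvd_mono: "M dvd M' \<Longrightarrow> period_of M' n \<Longrightarrow> period_of M n"
  unfolding is_fib_period_def using dvd_trans by blast

lemma le_power_p: "e \<le> p ^ e"
  using prime_ge_2_nat[OF prime_p] by (metis less_exp less_imp_le order_trans power_mono zero_le)

lemma exists_period: "\<exists>n>0. period_of (P ^ e) n"
proof -
  obtain n where n: "n > 0" "period_of P n"
    using exists_period_P by blast
  then have "period_of (P ^ (1 * p ^ e)) (n * p ^ e)"
    by (intro period_mult_p_power) simp
  then have "period_of (P ^ e) (n * p ^ e)"
    by (rule period_dvd_mono[rotated]) (simp add: le_imp_power_dvd le_power_p)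
  then show ?thesis
    using n p_pos by (intro exI[of _ "n * p ^ e"]) simp
qed

lemma rank_iff:
  assumes "e > 0"
  shows "P ^ e dvd F n \<longleftrightarrow> fib_rank a b (P ^ e) dvd n"
proof -
  obtain N where "N > 0" "P ^ e dvd F N"
    using exists_period is_fib_period_def by metis
  moreover have "P ^ e dvd F (m + n)" if "P ^ e dvd F m" "P ^ e dvd F n" for m n
    using that by (simp add: gfib_add)
  moreover have "P ^ e dvd F m" if "P ^ e dvd F (m + n)" "P ^ e dvd F n" for m n
  proof (rule prime_elem_power_dvd_mult_cancel[OF prime_P])
    show "\<not> P dvd G n"
      using prime_elem_not_dvd_cofib[OF prime_P not_P_dvd_b] that(2) P_dvd_power[OF assms]
        dvd_trans by blast
    have "F m * G n = F (m + n) - (a * F m + G m) * F n"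
      by (simp add: gfib_add algebra_simps)
    then show "P ^ e dvd F m * G n"
      using that by simp
  qed
  ultimately show ?thesis
    unfolding fib_rank_def rank_iff_cong
    using Least_dvd_iff[of "\<lambda>n. P ^ e dvd F n" N n] by blast
qed

lemma period_iff: "period_of (P ^ e) n \<longleftrightarrow> fib_period a b (P ^ e) dvd n"
proof -
  obtain N where "N > 0" "period_of (P ^ e) N"
    using exists_period by metis
  moreover have "period_of (P ^ e) (m + n)" if "period_of (P ^ e) m" "period_of (P ^ e) n" for m n
  proof -
    have "G (m + n) - 1 = b * F m * F n + G m * (G n - 1) + (G m - 1)"
      by (simp add: cofib_add algebra_simps)
    then have "P ^ e dvd G (m + n) - 1"
      using that by (simp only: is_fib_period_def dvd_add dvd_mult)
    then show ?thesis
      using that by (simp add: is_fib_period_def gfib_add)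
  qed
  moreover have "period_of (P ^ e) m" if "period_of (P ^ e) (m + n)" "period_of (P ^ e) n" for m n
  proof (rule is_fib_period_cancel[OF prime_P not_P_dvd_b])
    show "P ^ e dvd F (n + m) - F n" "P ^ e dvd G (n + m) - G n"
      using that dvd_diff[of "P ^ e" "G (m + n) - 1" "G n - 1"]
      by (simp_all add: is_fib_period_def add.commute)
  qed
  ultimately show ?thesis
    unfolding fib_period_def period_iff_cong
    using Least_dvd_iff[of "\<lambda>n. period_of (P ^ e) n" N n] by blast
qed

abbreviation "\<alpha> e \<equiv> fib_rank a b (P ^ e)"
abbreviation "\<pi> e \<equiv> fib_period a b (P ^ e)"

lemma period_pos: "\<pi> e > 0"
  using exists_period[of e] period_iff[of e] by (metis dvd_0_left_iff gr0I)

lemma rank_dvd_period: "e > 0 \<Longrightarrow> \<alpha> e dvd \<pi> e"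
  using rank_iff[of e "\<pi> e"] period_iff[of e "\<pi> e"] by (simp add: is_fib_period_def)

lemma rank_pos: "e > 0 \<Longrightarrow> \<alpha> e > 0"
  using rank_dvd_period period_pos by (metis dvd_0_left_iff gr0I less_numeral_extra(3))

text \<open>The rank modulo \<open>P\<^sup>e\<close> lies, for divisibility, between \<open>\<alpha>(P)\<close> and a \<open>p\<close>-power multiple of it.\<close>
lemma rank_eq_times_power:
  assumes "e > 0"
  shows "\<exists>i. \<alpha> e = \<alpha> 1 * p ^ i"
proof (rule dvd_between_prime_power[OF prime_p])
  have "P ^ e dvd F (\<alpha> e)"
    using rank_iff[OF assms] by simp
  then have "P ^ 1 dvd F (\<alpha> e)"
    using P_dvd_power[OF assms] dvd_trans by auto
  then show "\<alpha> 1 dvd \<alpha> e"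
    using rank_iff[OF zero_less_one] by blast
  have "P ^ (1 * p ^ e) dvd F (\<alpha> 1 * p ^ e)"
    using rank_iff[of 1 "\<alpha> 1"] by (intro rank_mult_p_power) simp
  then have "P ^ e dvd F (\<alpha> 1 * p ^ e)"
    by (rule dvd_trans[rotated]) (simp add: le_imp_power_dvd le_power_p)
  then show "\<alpha> e dvd \<alpha> 1 * p ^ e"
    using rank_iff[OF assms] by blast
  show "\<alpha> 1 > 0"
    by (rule rank_pos) simp
qed

lemma period_eq_times_power:
  assumes "e > 0"
  shows "\<exists>j. \<pi> e = \<pi> 1 * p ^ j"
proof (rule dvd_between_prime_power[OF prime_p])
  have "period_of (P ^ e) (\<pi> e)"
    using period_iff by simp
  then have "period_of (P ^ 1) (\<pi> e)"
    by (rule period_dvd_mono[rotated]) (simp add: P_dvd_power assms)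
  then show "\<pi> 1 dvd \<pi> e"
    using period_iff by blast
  have "period_of (P ^ (1 * p ^ e)) (\<pi> 1 * p ^ e)"
    using period_iff[of 1 "\<pi> 1"] by (intro period_mult_p_power) simp
  then have "period_of (P ^ e) (\<pi> 1 * p ^ e)"
    by (rule period_dvd_mono[rotated]) (simp add: le_imp_power_dvd le_power_p)
  then show "\<pi> e dvd \<pi> 1 * p ^ e"
    using period_iff by blast
  show "\<pi> 1 > 0"
    by (rule period_pos)
qed

text \<open>If \<open>\<beta>(P)\<close> were divisible by \<open>p\<close>, then \<open>n = \<pi>(P) / p\<close> would still be a multiple of the rank, so
  \<open>T\<^sup>n\<close> would be a scalar whose \<open>p\<close>-th power is \<open>1\<close>.  In characteristic \<open>p\<close> that scalar is \<open>1\<close>,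
  against the minimality of \<open>\<pi>(P)\<close>.\<close>
lemma not_p_dvd_period_div_rank:
  assumes c: "\<pi> 1 = \<alpha> 1 * c"
  shows "\<not> p dvd c"
proof
  assume "p dvd c"
  then obtain d where d: "c = d * p"
    by (metis dvdE mult.commute)
  define n where "n = \<alpha> 1 * d"
  have \<pi>: "\<pi> 1 = n * p"
    unfolding c d n_def by (simp only: mult.assoc)
  have "P dvd F n"
    using rank_iff[of 1 n] by (simp add: n_def)
  moreover have "P dvd G n - 1"
  proof -
    have "P dvd G (n * p) - 1"
      using period_iff[of 1 "\<pi> 1"] unfolding \<pi> by (simp add: is_fib_period_def)
    moreover have "P dvd F n ^ p"
      using dvd_trans[OF \<open>P dvd F n\<close> dvd_power] p_pos by blast
    moreover have "(G n - 1) ^ p = (G (n * p) - 1) - F n ^ p * G p"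
      by (simp add: G_mult_p power_p_diff)
    ultimately have "P dvd (G n - 1) ^ p"
      by simp
    then show ?thesis
      by (rule prime_elem_dvd_power[OF prime_P])
  qed
  ultimately have "\<pi> 1 dvd n"
    using period_iff[of 1 n] by (simp add: is_fib_period_def)
  moreover have "n > 0"
    using period_pos[of 1] \<pi> by simp
  ultimately have "n * p \<le> n * 1"
    using \<pi> dvd_imp_le by simp
  with \<open>n > 0\<close> prime_gt_1_nat[OF prime_p] show False
    by simp
qed

lemma rank_exponent_le_period_exponent:
  assumes "e > 0" "\<alpha> e = \<alpha> 1 * p ^ i" "\<pi> e = \<pi> 1 * p ^ j"
  shows "i \<le> j"
proof -
  obtain c where c: "\<pi> 1 = \<alpha> 1 * c"
    using rank_dvd_period[of 1] by (auto elim: dvdE)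
  have "\<alpha> 1 * p ^ i dvd \<alpha> 1 * (c * p ^ j)"
    using rank_dvd_period[OF assms(1)] unfolding assms(2,3) c by (simp add: mult.assoc)
  then have "p ^ i dvd c * p ^ j"
    using rank_pos[of 1] by simp
  moreover have "coprime (p ^ i) c"
    using prime_imp_coprime[OF prime_p not_p_dvd_period_div_rank[OF c]] by simp
  ultimately have "p ^ i dvd p ^ j"
    by (simp add: coprime_dvd_mult_right_iff)
  then show ?thesis
    using prime_gt_1_nat[OF prime_p] by (simp add: dvd_power_iff_le power_dvd_imp_le)
qed

text \<open>If \<open>P\<close> divides \<open>F\<^sub>p\<close>, the rank \<open>\<alpha>(P)\<close> divides the prime \<open>p\<close> and is not \<open>1\<close>, since \<open>F\<^sub>1 = 1\<close>.  Hence
  \<open>\<alpha>(P) = p\<close>.\<close>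
lemma valuation_F_p_le:
  assumes "\<not> P ^ Suc v dvd F (\<alpha> 1)"
  shows "\<exists>w\<le>v. \<not> P ^ Suc w dvd F p"
proof (cases "P dvd F p")
  case True
  then have "\<alpha> 1 dvd p"
    using rank_iff[of 1 p] by simp
  moreover have "\<alpha> 1 \<noteq> 1"
    using rank_iff[of 1 1] prime_P by (auto simp: prime_elem_def)
  ultimately have "\<alpha> 1 = p"
    using prime_p prime_nat_iff by blast
  with assms show ?thesis
    by auto
qed (auto intro: exI[of _ 0])

text \<open>\<open>F\<^sub>n\<^sub>p = F\<^sub>n\<^sup>p F\<^sub>p\<close> sends a valuation \<open>u\<close> to \<open>p u + w\<close>.  To absorb the terms \<open>w \<le> v\<close> for all \<open>i\<close>,
  the induction carries the stronger bound \<open>u + w \<le> p\<^sup>i\<^sup>+\<^sup>1 v\<close>, which is preserved because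
  \<open>p u + 2 w \<le> p (u + w)\<close>; the exponent starts at 1 because initially \<open>v + w \<le> 2 v \<le> p v\<close>.\<close>
lemma valuation_F_le:
  assumes v: "\<not> P ^ Suc v dvd F (\<alpha> 1)" and e: "P ^ e dvd F (\<alpha> 1 * p ^ i)"
  shows "e \<le> p ^ Suc i * v"
proof -
  obtain w where w: "w \<le> v" "\<not> P ^ Suc w dvd F p"
    using valuation_F_p_le[OF v] by blast
  have "\<exists>u. u + w \<le> p ^ Suc i * v \<and> \<not> P ^ Suc u dvd F (\<alpha> 1 * p ^ i)"
  proof (induction i)
    case 0
    have "v + w \<le> 2 * v"
      using w by simp
    also have "\<dots> \<le> p * v"
      using prime_ge_2_nat[OF prime_p] by simp
    finally show ?case
      using v by auto
  next
    case (Suc i)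
    then obtain u where u: "u + w \<le> p ^ Suc i * v" "\<not> P ^ Suc u dvd F (\<alpha> 1 * p ^ i)"
      by blast
    have "\<not> P ^ Suc (p * u + w) dvd F (\<alpha> 1 * p ^ i) ^ p * F p"
      using prime_elem_power_not_dvd_mult prime_elem_power_not_dvd_power prime_P u(2) w(2) by blast
    then have "\<not> P ^ Suc (p * u + w) dvd F (\<alpha> 1 * p ^ Suc i)"
      using F_mult_p[of "\<alpha> 1 * p ^ i"] by (simp add: ac_simps)
    moreover have "(p * u + w) + w \<le> p ^ Suc (Suc i) * v"
    proof -
      have "(p * u + w) + w = p * u + 2 * w"
        by simp
      also have "\<dots> \<le> p * (u + w)"
        unfolding distrib_left using prime_ge_2_nat[OF prime_p] by (intro add_mono mult_le_mono) auto
      also have "\<dots> \<le> p * (p ^ Suc i * v)"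
        using u(1) by (rule mult_le_mono2)
      finally show ?thesis
        by (simp add: ac_simps)
    qed
    ultimately show ?case
      by blast
  qed
  then obtain u where u: "u + w \<le> p ^ Suc i * v" "\<not> P ^ Suc u dvd F (\<alpha> 1 * p ^ i)"
    by blast
  have "e \<le> u"
    using e u(2) by (meson dvd_trans le_imp_power_dvd not_less_eq_eq)
  with u(1) show ?thesis
    by linarith
qed

text \<open>Starting from the period \<open>\<pi>(P)\<close> modulo \<open>P\<^sup>\<mu>\<close>, raising to the power \<open>p\<^sup>m\<close> with \<open>m = k + 1 + i\<close>
  reaches the exponent \<open>\<mu> p\<^sup>m\<close>, which is large enough for \<open>P\<^sup>e\<close> by the bound on valuations.\<close>
lemma period_exponent_le:
  assumes v: "\<not> P ^ Suc v dvd F (\<alpha> 1)"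
    and \<mu>: "period_of (P ^ \<mu>) (\<pi> 1)"
    and le: "v \<le> p ^ k * \<mu>"
    and "e > 0" "\<alpha> e = \<alpha> 1 * p ^ i"
  shows "\<pi> e \<le> \<pi> 1 * p ^ (k + 1 + i)"
proof -
  let ?m = "k + 1 + i"
  have "P ^ e dvd F (\<alpha> 1 * p ^ i)"
    using rank_iff[OF \<open>e > 0\<close>] assms(5) by simp
  then have "e \<le> p ^ Suc i * v"
    by (rule valuation_F_le[OF v])
  also have "\<dots> \<le> p ^ Suc i * (p ^ k * \<mu>)"
    using le by simp
  also have "\<dots> = \<mu> * p ^ ?m"
    by (simp add: power_add)
  finally have "period_of (P ^ e) (\<pi> 1 * p ^ ?m)"
    using period_mult_p_power[OF \<mu>, of ?m] period_dvd_mono le_imp_power_dvd by blast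
  then have "\<pi> e dvd \<pi> 1 * p ^ ?m"
    using period_iff by blast
  then show ?thesis
    using period_pos[of 1] p_pos by (intro dvd_imp_le) auto
qed

text \<open>A nonzero polynomial is not divisible by all powers of \<open>P\<close>.\<close>
lemma rank_not_constant:
  assumes "\<And>n. n > 0 \<Longrightarrow> F n \<noteq> 0"
  shows "\<exists>e>0. \<alpha> e \<noteq> \<alpha> 1"
proof (rule ccontr)
  assume "\<not> ?thesis"
  then have "P ^ Suc e dvd F (\<alpha> 1)" for e
    using rank_iff[of "Suc e" "\<alpha> 1"] by (metis dvd_refl zero_less_Suc)
  then have "F (\<alpha> 1) = 0"
    using power_dvd_all_imp_0 irreducible_P by blast
  with assms rank_pos[of 1] show False by simp
qed

lemma period_not_constant:
  assumes "\<And>n. n > 0 \<Longrightarrow> F n \<noteq> 0"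
  shows "\<exists>e>0. \<pi> e \<noteq> \<pi> 1"
proof (rule ccontr)
  assume "\<not> ?thesis"
  then have "P ^ Suc e dvd F (\<pi> 1)" for e
    using period_iff[of "Suc e" "\<pi> 1"] unfolding is_fib_period_def by (metis dvd_refl zero_less_Suc)
  then have "F (\<pi> 1) = 0"
    using power_dvd_all_imp_0 irreducible_P by blast
  with assms period_pos[of 1] show False by simp
qed

text \<open>Up to the first jump \<open>v\<close> the rank is \<open>\<alpha>(P)\<close>.  If \<open>P\<^sup>v\<^sup>+\<^sup>1\<close> divided \<open>F\<^sub>n\<close> for \<open>n = \<alpha>(P)\<close>, it would
  still be \<open>\<alpha>(P)\<close> modulo \<open>P\<^sup>v\<^sup>+\<^sup>1\<close>, and \<open>v\<close> would not be a jump.\<close>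
lemma rank_jump_1:
  assumes "\<And>n. n > 0 \<Longrightarrow> F n \<noteq> 0"
  shows "\<not> P ^ Suc (rank_jump a b P 1) dvd F (\<alpha> 1)"
proof
  define v where "v = rank_jump a b P 1"
  have "v = enumerate {e. e > 0 \<and> \<alpha> e \<noteq> \<alpha> (e + 1)} 0"
    by (simp add: v_def rank_jump_def)
  note jump = Least_change[of \<alpha>, OF rank_not_constant[OF assms], folded this]
  assume "P ^ Suc (rank_jump a b P 1) dvd F (\<alpha> 1)"
  then have "\<alpha> (Suc v) dvd \<alpha> 1"
    using rank_iff[of "Suc v"] v_def by simp
  moreover have "\<alpha> 1 dvd \<alpha> (Suc v)"
    using rank_eq_times_power[of "Suc v"] by auto
  ultimately have "\<alpha> (Suc v) = \<alpha> 1"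
    by (simp add: dvd_antisym)
  with jump show False by simp
qed

lemma period_jump_1:
  assumes "\<And>n. n > 0 \<Longrightarrow> F n \<noteq> 0"
  shows "period_jump a b P 1 > 0" and "period_of (P ^ period_jump a b P 1) (\<pi> 1)"
proof -
  define m where "m = period_jump a b P 1"
  have "m = enumerate {e. e > 0 \<and> \<pi> e \<noteq> \<pi> (e + 1)} 0"
    by (simp add: m_def period_jump_def)
  note jump = Least_change[of \<pi>, OF period_not_constant[OF assms], folded this]
  show "period_jump a b P 1 > 0"
    using jump(1) by (simp add: m_def)
  have "period_of (P ^ m) (\<pi> m)"
    using period_iff by simp
  then show "period_of (P ^ period_jump a b P 1) (\<pi> 1)"
    by (simp only: jump(2) flip: m_def)
qed

end

theorem theorem6p2:
  fixes a b P :: "'a::{field,finite} poly"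
    and p l k e :: nat
  assumes "prime p" and "l \<ge> 1" and "card (UNIV :: 'a set) = p ^ l"
    and "b \<noteq> 0"
    and "irreducible P" and "coprime b P"
    and "a ^ 2 + 4 * b \<noteq> 0"
    and "to_fract (a ^ 2) / to_fract b \<notin> range (\<lambda>c::'a. to_fract [:c:])"
    and "k \<ge> 1"
    and "(of_nat (rank_jump a b P 1) / of_nat (period_jump a b P 1) :: rat) \<le> of_nat (p ^ k)"
    and "e > rank_jump a b P (k + 2)"
  shows "fib_beta a b P \<le> fib_beta a b (P ^ e) \<and>
         fib_beta a b (P ^ e) \<le> of_nat (p ^ (k + 1)) * fib_beta a b P"
proof -
  interpret gfib_mod_prime a b P p
    using assms CHAR_finite_field by unfold_locales auto
  have nonzero: "F n \<noteq> 0" if "n > 0" for n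
    using gfib_nonzero assms(4,8) that by blast
  note not_dvd = rank_jump_1[OF nonzero]
  note period_jump = period_jump_1[OF nonzero]
  have "(of_nat (rank_jump a b P 1) :: rat) \<le> of_nat (p ^ k * period_jump a b P 1)"
    using assms(10) period_jump(1) by (simp add: divide_le_eq)
  then have le: "rank_jump a b P 1 \<le> p ^ k * period_jump a b P 1"
    by (simp only: of_nat_le_iff)
  have "e > 0"
    using assms(11) by simp
  then obtain i j where i: "\<alpha> e = \<alpha> 1 * p ^ i" and j: "\<pi> e = \<pi> 1 * p ^ j"
    using rank_eq_times_power period_eq_times_power by blast
  have \<beta>: "fib_beta a b (P ^ e) = of_nat (\<pi> e) / (of_nat (\<alpha> 1) * of_nat (p ^ i))"
    by (simp add: fib_beta_def i)
  have pos: "0 < (of_nat (\<alpha> 1) :: rat)" "0 < (of_nat (p ^ i) :: rat)"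
    using rank_pos[of 1] p_pos by simp_all
  have "\<pi> 1 * p ^ i \<le> \<pi> e"
    using rank_exponent_le_period_exponent[OF \<open>e > 0\<close> i j] p_pos
    unfolding j by (simp add: power_increasing)
  then have "(of_nat (\<pi> 1 * p ^ i) :: rat) \<le> of_nat (\<pi> e)"
    by (simp only: of_nat_le_iff)
  then have lower: "of_nat (\<pi> 1) / of_nat (\<alpha> 1) \<le> fib_beta a b (P ^ e)"
    using pos unfolding \<beta> by (simp add: field_simps)
  have "\<pi> e \<le> \<pi> 1 * p ^ (k + 1 + i)"
    by (rule period_exponent_le[OF not_dvd period_jump(2) le \<open>e > 0\<close> i])
  then have "(of_nat (\<pi> e) :: rat) \<le> of_nat (\<pi> 1 * p ^ (k + 1 + i))"
    by (simp only: of_nat_le_iff)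
  then have "(of_nat (\<pi> e) :: rat) \<le> of_nat (p ^ (k + 1)) * of_nat (\<pi> 1) * of_nat (p ^ i)"
    by (simp add: power_add ac_simps)
  then have upper: "fib_beta a b (P ^ e) \<le> of_nat (p ^ (k + 1)) * (of_nat (\<pi> 1) / of_nat (\<alpha> 1))"
    using pos unfolding \<beta> by (simp add: field_simps)
  have "fib_beta a b P = of_nat (\<pi> 1) / of_nat (\<alpha> 1)"
    by (simp add: fib_beta_def)
  with lower upper show ?thesis
    by simp
qed

end
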